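(* Let $P$ be an $n\times n$ stochastic matrix, irreducible, on a finite state space $\mathcal X$ with $|\mathcal X|=n$, with stationary distribution $\pi$ satisfying $\pi(x)>0$ for all $x\in\mathcal X$. Let $P^*$ be the adjoint of $P$ in $l^2(\pi)$, and let $M_1,M_2$ be the first and second Metropolis-Hastings (MH) kernels of $P$. For a self-adjoint matrix $K$ on $l^2(\pi)$ write $\lambda_1(K)\ge\dots\ge\lambda_n(K)$ for its eigenvalues. (i) For all integers $i,j,k$ with $1\le i,j,k\le n$ and $i+1=j+k$, $$\lambda_i(P+P^* )\le \lambda_j(M_1)+\lambda_k(M_2).$$ Equality holds if and only if there exists a vector $f$ with $\|f\|_{l^2(\pi)}=1$ such that $M_1f=\lambda_j(M_1) f$, $M_2f=\lambda_k(M_2) f$ and $(P+P^* )f=\lambda_i(P+P^* ) f$. (ii) For all integers $i,l,m$ with $1\le i,l,m\le n$ and $i+n=l+m$, $$\lambda_i(P+P^* )\ge \lambda_l(M_1)+\lambda_m(M_2).$$ Equality holds if and only if there exists a vector $f$ with $\|f\|_{l^2(\pi)}=1$ such that $M_1f=\lambda_l(M_1) f$, $M_2f=\lambda_m(M_2) f$ and $(P+P^* )f=\lambda_i(P+P^* ) f$.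
   Context: $l^2(\pi)$ is the space of functions on $\mathcal X$ with inner product $\langle f,g\rangle_\pi=\sum_x f(x)\overline{g(x)}\pi(x)$. The adjoint (time-reversal) is $P^*(x,y)=\pi(y)P(y,x)/\pi(x)$. The first and second MH kernels are the matrices given, for $x\ne y$, by $$M_1(x,y)=\min\{P(x,y),P^*(x,y)\},\qquad M_2(x,y)=\max\{P(x,y),P^*(x,y)\},$$ and on the diagonal by $M_1(x,x)=P(x,x)+r_1(x)$, $M_2(x,x)=P(x,x)-r_1(x)$, where $r_1(x)=\sum_{y\ne x}\bigl(P(x,y)-\min\{P(x,y),P^*(x,y)\}\bigr)$. Both are self-adjoint on $l^2(\pi)$ with row sums equal to $1$; $M_2$ may have negative diagonal entries. *)

theory Defs
  imports "HOL-Analysis.Analysis" "HOL-Computational_Algebra.Polynomial"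
begin

text \<open>
  The state space is a finite type \<open>'s\<close>, so that the number of states is \<open>CARD('s)\<close>. Kernels are
  real matrices \<open>K\<close> with entries \<open>K(x,y) = K $ x $ y\<close>; elements of \<open>l\<^sup>2(\<pi>)\<close> are complex vectors
  indexed by the states.
\<close>

definition stochastic :: "real^'s^'s \<Rightarrow> bool" where
  "stochastic P \<longleftrightarrow> (\<forall>x y. 0 \<le> P $ x $ y) \<and> (\<forall>x. (\<Sum>y\<in>UNIV. P $ x $ y) = 1)"

text \<open>The matrix product is \<open>**\<close>; the class operations \<open>*\<close> and \<open>^\<close> on vectors act entrywise.\<close>

definition matrix_pow :: "real^'s^'s \<Rightarrow> nat \<Rightarrow> real^'s^'s" where
  "matrix_pow P k = (((**) P) ^^ k) (mat 1)"

definition irreducible_matrix :: "real^'s^'s \<Rightarrow> bool" where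
  "irreducible_matrix P \<longleftrightarrow> (\<forall>x y. \<exists>k. matrix_pow P k $ x $ y > 0)"

definition stationary_distribution :: "real^'s \<Rightarrow> real^'s^'s \<Rightarrow> bool" where
  "stationary_distribution \<pi> P \<longleftrightarrow>
     (\<forall>x. 0 \<le> \<pi> $ x) \<and> (\<Sum>x\<in>UNIV. \<pi> $ x) = 1 \<and> \<pi> v* P = \<pi>"

definition l2_inner :: "real^'s \<Rightarrow> complex^'s \<Rightarrow> complex^'s \<Rightarrow> complex" where
  "l2_inner \<pi> f g = (\<Sum>x\<in>UNIV. f $ x * cnj (g $ x) * complex_of_real (\<pi> $ x))"

definition l2_norm :: "real^'s \<Rightarrow> complex^'s \<Rightarrow> real" where
  "l2_norm \<pi> f = sqrt (Re (l2_inner \<pi> f f))"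

definition kernel_apply :: "real^'s^'s \<Rightarrow> complex^'s \<Rightarrow> complex^'s" where
  "kernel_apply K f = map_matrix complex_of_real K *v f"

definition self_adjoint_l2 :: "real^'s \<Rightarrow> real^'s^'s \<Rightarrow> bool" where
  "self_adjoint_l2 \<pi> K \<longleftrightarrow>
     (\<forall>f g. l2_inner \<pi> (kernel_apply K f) g = l2_inner \<pi> f (kernel_apply K g))"

definition l2_adjoint :: "real^'s \<Rightarrow> real^'s^'s \<Rightarrow> real^'s^'s" where
  "l2_adjoint \<pi> P = (\<chi> x y. \<pi> $ y * P $ y $ x / \<pi> $ x)"

definition MH_rejection :: "real^'s \<Rightarrow> real^'s^'s \<Rightarrow> 's \<Rightarrow> real" where
  "MH_rejection \<pi> P x =
     (\<Sum>y\<in>UNIV - {x}. P $ x $ y - min (P $ x $ y) (l2_adjoint \<pi> P $ x $ y))"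

definition MH1 :: "real^'s \<Rightarrow> real^'s^'s \<Rightarrow> real^'s^'s" where
  "MH1 \<pi> P = (\<chi> x y. if x = y then P $ x $ x + MH_rejection \<pi> P x
                       else min (P $ x $ y) (l2_adjoint \<pi> P $ x $ y))"

definition MH2 :: "real^'s \<Rightarrow> real^'s^'s \<Rightarrow> real^'s^'s" where
  "MH2 \<pi> P = (\<chi> x y. if x = y then P $ x $ x - MH_rejection \<pi> P x
                       else max (P $ x $ y) (l2_adjoint \<pi> P $ x $ y))"

definition charpoly :: "real^'s^'s \<Rightarrow> real poly" where
  "charpoly K = det (mat [:0, 1:] - map_matrix (\<lambda>c. [:c:]) K)"

text \<open>
  \<open>eigval K i\<close> is the \<open>i\<close>-th largest eigenvalue, counted with multiplicity and numbered from \<open>1\<close>.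
  It is meant for kernels that are self-adjoint on \<open>l\<^sup>2(\<pi>)\<close>: their characteristic polynomial
  has only real roots, so the list below has exactly \<open>CARD('s)\<close> entries. For other matrices non-real
  eigenvalues are omitted.
\<close>

definition eigvals_desc :: "real^'s^'s \<Rightarrow> real list" where
  "eigvals_desc K = rev (sorted_list_of_multiset (proots (charpoly K)))"

definition eigval :: "real^'s^'s \<Rightarrow> nat \<Rightarrow> real" where
  "eigval K i = eigvals_desc K ! (i - 1)"

lemma l2_adjoint_adjoint:
  assumes "\<And>x. \<pi> $ x > 0"
  shows "l2_inner \<pi> (kernel_apply P f) g = l2_inner \<pi> f (kernel_apply (l2_adjoint \<pi> P) g)"
proof -
  have ne: "complex_of_real (\<pi> $ x) \<noteq> 0" for x
    using assms[of x] by simp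
  have "l2_inner \<pi> (kernel_apply P f) g =
      (\<Sum>x\<in>UNIV. \<Sum>y\<in>UNIV. complex_of_real (P $ x $ y) * f $ y * cnj (g $ x) * complex_of_real (\<pi> $ x))"
    by (simp add: l2_inner_def kernel_apply_def matrix_vector_mult_def sum_distrib_right)
  also have "\<dots> = (\<Sum>y\<in>UNIV. \<Sum>x\<in>UNIV. complex_of_real (P $ x $ y) * f $ y * cnj (g $ x) * complex_of_real (\<pi> $ x))"
    by (rule sum.swap)
  also have "\<dots> = l2_inner \<pi> f (kernel_apply (l2_adjoint \<pi> P) g)"
    using ne by (simp add: l2_inner_def kernel_apply_def matrix_vector_mult_def l2_adjoint_def sum_distrib_right sum_distrib_left
        mult_ac)
  finally show ?thesis .
qed

lemma self_adjoint_l2I: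
  assumes "\<And>x. \<pi> $ x > 0" and "\<And>x y. \<pi> $ x * K $ x $ y = \<pi> $ y * K $ y $ x"
  shows "self_adjoint_l2 \<pi> K"
proof -
  have "\<pi> $ y * K $ y $ x / \<pi> $ x = K $ x $ y" for x y
    using assms(1)[of x] assms(2)[of x y] by (simp add: field_simps)
  hence "l2_adjoint \<pi> K = K"
    by (simp add: l2_adjoint_def vec_eq_iff)
  thus ?thesis
    using l2_adjoint_adjoint[OF assms(1), of K] by (simp add: self_adjoint_l2_def)
qed

lemma self_adjoint_additive_reversibilization:
  assumes pos: "\<And>x. \<pi> $ x > 0"
  shows "self_adjoint_l2 \<pi> (P + l2_adjoint \<pi> P)"
proof (rule self_adjoint_l2I[OF pos])
  fix x y
  show "\<pi> $ x * (P + l2_adjoint \<pi> P) $ x $ y = \<pi> $ y * (P + l2_adjoint \<pi> P) $ y $ x"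
    using pos[of x] pos[of y] by (simp add: l2_adjoint_def field_simps)
qed

lemma self_adjoint_MH1:
  assumes pos: "\<And>x. \<pi> $ x > 0"
  shows "self_adjoint_l2 \<pi> (MH1 \<pi> P)"
proof (rule self_adjoint_l2I[OF pos])
  fix x y
  show "\<pi> $ x * MH1 \<pi> P $ x $ y = \<pi> $ y * MH1 \<pi> P $ y $ x"
    using pos[of x] pos[of y]
    by (auto simp: MH1_def l2_adjoint_def min_mult_distrib_left min.commute)
qed

lemma self_adjoint_MH2:
  assumes pos: "\<And>x. \<pi> $ x > 0"
  shows "self_adjoint_l2 \<pi> (MH2 \<pi> P)"
proof (rule self_adjoint_l2I[OF pos])
  fix x y
  show "\<pi> $ x * MH2 \<pi> P $ x $ y = \<pi> $ y * MH2 \<pi> P $ y $ x"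
    using pos[of x] pos[of y]
    by (auto simp: MH2_def l2_adjoint_def max_mult_distrib_left max.commute)
qed

end

theory Submission
  imports Defs
begin

text \<open>
  The two Metropolis-Hastings kernels satisfy \<open>M\<^sub>1 + M\<^sub>2 = P + P\<^sup>*\<close> (lemma \<open>MH1_plus_MH2\<close>), and all
  three matrices are self-adjoint on \<open>l\<^sup>2(\<pi>)\<close>. The theorem is therefore Weyl's inequality for a sum
  of self-adjoint operators, together with its equality case.

  For the upper bound, consider the span of the eigenvectors of \<open>M\<^sub>1\<close> numbered \<open>j, \<dots>, n\<close>, the span of
  those of \<open>M\<^sub>2\<close> numbered \<open>k, \<dots>, n\<close>, and the span of those of \<open>P + P\<^sup>*\<close> numbered \<open>1, \<dots>, i\<close>. The
  dimensions add up to \<open>2n + 1\<close>, so the three spaces share a vector \<open>x \<noteq> 0\<close>. Its Rayleigh quotient is at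
  most \<open>\<lambda>\<^sub>j(M\<^sub>1)\<close> for \<open>M\<^sub>1\<close>, at most \<open>\<lambda>\<^sub>k(M\<^sub>2)\<close> for \<open>M\<^sub>2\<close>, and at least \<open>\<lambda>\<^sub>i(P + P\<^sup>*)\<close> for their sum. If the
  resulting inequality is an equality, all three bounds are attained at \<open>x\<close>, and on such spans that
  happens only at eigenvectors. Conversely, a common eigenvector makes the eigenvalues add. The lower bound is
  the same argument with the two kinds of spans exchanged. This is carried by
  \<open>rayleigh_le_zero_sum\<close>.

  Eigenvalues are defined as sorted roots of the characteristic polynomial. To connect them with
  eigenvectors, conjugation by the diagonal matrix of \<open>sqrt \<pi>\<close> turns self-adjoint kernels into real
  symmetric matrices without changing the characteristic polynomial. These have orthonormal
  eigenbases (\<open>symmetric_orthonormal_eigenbasis\<close>), whose eigenvalues in decreasing order are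
  the listed roots (\<open>symmetric_sorted_eigenbasis\<close>).
\<close>

section \<open>Rayleigh bounds on intersecting subspaces\<close>

text \<open>
  The second conjunct records rigidity: the bound on the Rayleigh quotient is attained only at
  eigenvectors. It holds on spans of eigenvectors with eigenvalues at most \<open>\<mu>\<close>, but not on arbitrary
  subspaces, and it is what yields the equality cases.
\<close>

definition rayleigh_le :: "real^'n^'n \<Rightarrow> real \<Rightarrow> (real^'n) set \<Rightarrow> bool" where
  "rayleigh_le A \<mu> U \<longleftrightarrow>
     (\<forall>x\<in>U. x \<bullet> (A *v x) \<le> \<mu> * (x \<bullet> x) \<and> (x \<bullet> (A *v x) = \<mu> * (x \<bullet> x) \<longrightarrow> A *v x = \<mu> *\<^sub>R x))"

lemma symmetric_inner_swap:
  fixes A :: "real^'n^'n"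
  assumes "transpose A = A"
  shows "(A *v x) \<bullet> y = x \<bullet> (A *v y)"
  using dot_lmul_matrix[of x A y] assms by (metis transpose_matrix_vector)

text \<open>
  In dimension \<open>n\<close>, intersecting with a subspace of dimension \<open>d\<close> lowers the dimension by at most
  \<open>n - d\<close>. The intersection of the three therefore has dimension at least
  \<open>dim U + dim V + dim W - 2n\<close>.
\<close>

lemma three_subspaces_common_vector:
  fixes U V W :: "'a::euclidean_space set"
  assumes "subspace U" "subspace V" "subspace W"
    and "2 * DIM('a) < dim U + dim V + dim W"
  obtains x where "x \<in> U" "x \<in> V" "x \<in> W" "x \<noteq> 0"
proof -
  have le: "dim T \<le> DIM('a)" for T :: "'a set"
    by (rule dim_subset_UNIV)
  have sub: "subspace (U \<inter> V)"
    using assms by (simp add: subspace_inter)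
  have 1: "dim {x + y |x y. x \<in> U \<and> y \<in> V} + dim (U \<inter> V) = dim U + dim V"
    by (rule dim_sums_Int[OF assms(1,2)])
  have 2: "dim {x + y |x y. x \<in> U \<inter> V \<and> y \<in> W} + dim (U \<inter> V \<inter> W) = dim (U \<inter> V) + dim W"
    by (rule dim_sums_Int[OF sub assms(3)])
  have "dim (U \<inter> V \<inter> W) \<noteq> 0"
    using 1 2 assms(4) le[of "{x + y |x y. x \<in> U \<and> y \<in> V}"]
      le[of "{x + y |x y. x \<in> U \<inter> V \<and> y \<in> W}"] by linarith
  then obtain x where "x \<in> U \<inter> V \<inter> W" "x \<noteq> 0"
    by (auto simp: dim_eq_0)
  then show thesis using that by blast
qed

text \<open>
  The argument behind both Weyl inequalities. Any common vector of the three subspaces forces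
  \<open>0 \<le> \<alpha> + \<beta> + \<gamma>\<close>, since its three Rayleigh quotients add up to zero. If the bound is attained,
  none of the three quotients can be smaller than its bound, and the rigidity built into
  \<^const>\<open>rayleigh_le\<close> turns the common vector into a common eigenvector. Having the matrices sum to zero
  keeps the roles symmetric: the upper inequality for \<open>A + B\<close> comes from the triple
  \<open>A, B, -(A + B)\<close>, the lower one from \<open>-A, -B, A + B\<close>.
\<close>

lemma rayleigh_le_zero_sum:
  fixes A B C :: "real^'n^'n"
  assumes zero: "A + B + C = 0"
    and sub: "subspace U" "subspace V" "subspace W"
    and dims: "2 * CARD('n) < dim U + dim V + dim W"
    and R: "rayleigh_le A \<alpha> U" "rayleigh_le B \<beta> V" "rayleigh_le C \<gamma> W"
  shows "0 \<le> \<alpha> + \<beta> + \<gamma>"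
    and "\<alpha> + \<beta> + \<gamma> = 0 \<Longrightarrow> \<exists>x. x \<noteq> 0 \<and> A *v x = \<alpha> *\<^sub>R x \<and> B *v x = \<beta> *\<^sub>R x"
proof -
  obtain x where x: "x \<in> U" "x \<in> V" "x \<in> W" "x \<noteq> 0"
    by (rule three_subspaces_common_vector[OF sub]) (use dims in simp)
  have "x \<bullet> (A *v x) + x \<bullet> (B *v x) + x \<bullet> (C *v x) = x \<bullet> ((A + B + C) *v x)"
    by (simp add: matrix_vector_mult_add_rdistrib inner_add_right)
  then have s: "x \<bullet> (A *v x) + x \<bullet> (B *v x) + x \<bullet> (C *v x) = 0"
    by (simp add: zero)
  have le: "x \<bullet> (A *v x) \<le> \<alpha> * (x \<bullet> x)" "x \<bullet> (B *v x) \<le> \<beta> * (x \<bullet> x)"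
      "x \<bullet> (C *v x) \<le> \<gamma> * (x \<bullet> x)"
    using R x by (auto simp: rayleigh_le_def)
  then have nonneg: "0 \<le> (\<alpha> + \<beta> + \<gamma>) * (x \<bullet> x)"
    using s by (simp add: distrib_right)
  moreover have pos: "x \<bullet> x > 0"
    using x by simp
  ultimately show "0 \<le> \<alpha> + \<beta> + \<gamma>"
    by (simp add: zero_le_mult_iff)
  assume "\<alpha> + \<beta> + \<gamma> = 0"
  then have "\<alpha> * (x \<bullet> x) + \<beta> * (x \<bullet> x) + \<gamma> * (x \<bullet> x) = 0"
    by (metis distrib_right mult_zero_left)
  then have "x \<bullet> (A *v x) = \<alpha> * (x \<bullet> x)" "x \<bullet> (B *v x) = \<beta> * (x \<bullet> x)"
    using le s by linarith+
  then show "\<exists>x. x \<noteq> 0 \<and> A *v x = \<alpha> *\<^sub>R x \<and> B *v x = \<beta> *\<^sub>R x"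
    using R x by (auto simp: rayleigh_le_def)
qed

section \<open>Eigenbases of symmetric matrices\<close>

text \<open>
  A maximizer \<open>v\<close> of the Rayleigh quotient on the unit sphere of \<open>V\<close> is an eigenvector. With \<open>\<mu>\<close> the
  maximum, the quadratic form \<open>q y = \<mu> (y \<bullet> y) - y \<bullet> A y\<close> is nonnegative on \<open>V\<close> and vanishes at \<open>v\<close>, so
  its derivative at \<open>v\<close> vanishes in every direction of \<open>V\<close>; the direction \<open>u = A v - \<mu> v\<close>, which
  lies in \<open>V\<close> by invariance, has derivative \<open>-2 (u \<bullet> u)\<close>.
\<close>

lemma symmetric_eigenvector_in_subspace:
  fixes A :: "real^'n^'n"
  assumes sym: "transpose A = A" and V: "subspace V" and inv: "\<And>x. x \<in> V \<Longrightarrow> A *v x \<in> V"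
    and ne: "dim V \<noteq> 0"
  obtains v \<mu> where "v \<in> V" "norm v = 1" "A *v v = \<mu> *\<^sub>R v"
proof -
  let ?K = "V \<inter> sphere 0 1"
  obtain w where w: "w \<in> V" "w \<noteq> 0"
    using ne by (auto simp: dim_eq_0)
  have "w /\<^sub>R norm w \<in> ?K"
    using w V by (simp add: subspace_scale)
  moreover have "compact ?K"
    using closed_subspace[OF V] by (simp add: closed_Int_compact)
  moreover have "continuous_on ?K (\<lambda>x. x \<bullet> (A *v x))"
    by (intro continuous_intros linear_continuous_on linear_linear[THEN iffD2] matrix_vector_mul_linear)
  ultimately obtain v where v: "v \<in> ?K" and max: "\<And>y. y \<in> ?K \<Longrightarrow> y \<bullet> (A *v y) \<le> v \<bullet> (A *v v)"
    using continuous_attains_sup[of ?K "\<lambda>x. x \<bullet> (A *v x)"] by blast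
  define \<mu> where "\<mu> = v \<bullet> (A *v v)"
  define q where "q y = \<mu> * (y \<bullet> y) - y \<bullet> (A *v y)" for y
  have q: "q y \<ge> 0" if "y \<in> V" for y
  proof (cases "y = 0")
    case False
    have "y /\<^sub>R norm y \<in> ?K"
      using that V False by (simp add: subspace_scale)
    from max[OF this] have "(y \<bullet> (A *v y)) / (norm y)\<^sup>2 \<le> \<mu>"
      by (simp add: \<mu>_def matrix_vector_mult_scaleR power2_eq_square divide_inverse mult_ac)
    then show ?thesis
      using False by (simp add: q_def power2_norm_eq_inner divide_le_eq)
  qed (simp add: q_def)
  have vv: "v \<in> V" "norm v = 1" "v \<bullet> v = 1"
    using v by (auto simp: norm_eq_1)
  define u where "u = A *v v - \<mu> *\<^sub>R v"
  have u: "u \<in> V"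
    unfolding u_def using vv inv V by (simp add: subspace_diff subspace_scale)
  have expand: "q (v + t *\<^sub>R u) = t\<^sup>2 * q u - 2 * t * (u \<bullet> u)" for t
  proof -
    have 1: "v \<bullet> (A *v u) = u \<bullet> (A *v v)"
      by (metis inner_commute sym symmetric_inner_swap)
    have 2: "u \<bullet> (A *v v) = u \<bullet> u + \<mu> * (u \<bullet> v)"
      by (simp add: u_def inner_simps)
    show ?thesis
      unfolding q_def using 1 2 vv(3)
      by (simp add: matrix_vector_right_distrib matrix_vector_mult_scaleR inner_simps
          \<mu>_def[symmetric] inner_commute[of v u] power2_eq_square algebra_simps)
  qed
  have "u \<bullet> u = 0"
  proof (rule ccontr)
    assume "u \<bullet> u \<noteq> 0"
    then have pos: "u \<bullet> u > 0" by simp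
    \<comment> \<open>a step so short that the linear term \<open>-2 t (u \<bullet> u)\<close> beats \<open>t\<^sup>2 q u\<close>; the \<open>1\<close> covers \<open>q u = 0\<close>\<close>
    define t where "t = (u \<bullet> u) / (q u + 1)"
    have qu: "q u \<ge> 0" by (rule q[OF u])
    have t: "t > 0" using pos qu by (simp add: t_def)
    have "t * q u \<le> u \<bullet> u"
      using qu pos by (simp add: t_def field_simps)
    then have "t * q u - 2 * (u \<bullet> u) < 0"
      using pos by linarith
    then have "t * (t * q u - 2 * (u \<bullet> u)) < 0"
      using t by (rule mult_pos_neg[rotated])
    moreover have "0 \<le> q (v + t *\<^sub>R u)"
      using q vv u V by (simp add: subspace_add subspace_scale)
    ultimately show False
      unfolding expand by (simp add: power2_eq_square algebra_simps)
  qed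
  then have "A *v v = \<mu> *\<^sub>R v" by (simp add: u_def)
  then show thesis using that vv by blast
qed

text \<open>
  The spectral theorem, stated for invariant subspaces so that the induction can split off one
  eigenvector and continue in its orthogonal complement.
\<close>

lemma symmetric_orthonormal_eigenbasis:
  fixes A :: "real^'n^'n"
  assumes sym: "transpose A = A" and V: "subspace V" and inv: "\<And>x. x \<in> V \<Longrightarrow> A *v x \<in> V"
  shows "\<exists>B. B \<subseteq> V \<and> finite B \<and> pairwise orthogonal B \<and> card B = dim V \<and>
           (\<forall>b\<in>B. norm b = 1 \<and> (\<exists>\<mu>. A *v b = \<mu> *\<^sub>R b))"
  using V inv
proof (induction "dim V" arbitrary: V)
  case 0
  then show ?case by (intro exI[of _ "{}"]) auto
next
  case (Suc d)
  then obtain v \<mu> where v: "v \<in> V" "norm v = 1" "A *v v = \<mu> *\<^sub>R v"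
    using symmetric_eigenvector_in_subspace[OF sym] by (metis nat.simps(3))
  define V' where "V' = {y \<in> V. \<forall>x \<in> span {v}. orthogonal x y}"
  have V'_eq: "V' = {y \<in> V. v \<bullet> y = 0}"
    unfolding V'_def by (auto simp: orthogonal_def span_singleton)
  have "dim V' + dim (span {v}) = dim V"
    unfolding V'_def using Suc.prems v
    by (intro dim_subspace_orthogonal_to_vectors) (auto simp: span_minimal)
  moreover have "dim (span {v}) = 1"
    using v by (metis dim_span dim_singleton norm_zero zero_neq_one)
  ultimately have dim: "d = dim V'" using Suc.hyps by simp
  have sub: "subspace V'"
    using Suc.prems(1) unfolding V'_eq subspace_def by (auto simp: inner_simps)
  have "v \<bullet> (A *v y) = 0" if "v \<bullet> y = 0" for y
    using symmetric_inner_swap[OF sym, of v y] v(3) that by simp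
  then have inv': "A *v y \<in> V'" if "y \<in> V'" for y
    using that Suc.prems by (auto simp: V'_eq)
  from Suc.hyps(1)[OF dim sub inv'] obtain B where
    B: "B \<subseteq> V'" "finite B" "pairwise orthogonal B" "card B = d"
      "\<And>b. b \<in> B \<Longrightarrow> norm b = 1 \<and> (\<exists>\<mu>. A *v b = \<mu> *\<^sub>R b)"
    using dim by metis
  have "v \<notin> B"
    using B(1) v(2) by (auto simp: V'_eq norm_eq_1)
  moreover have "pairwise orthogonal (insert v B)"
    using B(1,3) by (auto simp: pairwise_insert V'_eq orthogonal_def inner_commute)
  ultimately show ?case
    using B v Suc.hyps(2) by (intro exI[of _ "insert v B"]) (auto simp: V'_eq)
qed

text \<open>
  In coordinates \<open>x = (\<Sum>b\<in>B. c b *\<^sub>R b)\<close> the gap \<open>\<mu> (x \<bullet> x) - x \<bullet> A x\<close> is the sum of the nonnegative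
  terms \<open>(c b)\<^sup>2 (\<mu> - ev b)\<close>. If it vanishes, then \<open>x\<close> only involves eigenvectors for \<open>\<mu>\<close> itself.
\<close>

lemma rayleigh_le_span_eigenvectors:
  fixes A :: "real^'n^'n"
  assumes fin: "finite B" and orth: "pairwise orthogonal B" and norm: "\<And>b. b \<in> B \<Longrightarrow> norm b = 1"
    and eig: "\<And>b. b \<in> B \<Longrightarrow> A *v b = ev b *\<^sub>R b" and le: "\<And>b. b \<in> B \<Longrightarrow> ev b \<le> \<mu>"
  shows "rayleigh_le A \<mu> (span B)"
  unfolding rayleigh_le_def
proof (intro ballI)
  fix x assume "x \<in> span B"
  then obtain c where x: "x = (\<Sum>b\<in>B. c b *\<^sub>R b)"
    using span_finite[OF fin] by auto
  have Ax: "A *v x = (\<Sum>b\<in>B. (c b * ev b) *\<^sub>R b)"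
    unfolding x by (simp add: linear_sum[OF matrix_vector_mul_linear] matrix_vector_mult_scaleR eig)
  have inner: "x \<bullet> (\<Sum>b\<in>B. d b *\<^sub>R b) = (\<Sum>b\<in>B. c b * d b)" for d
  proof -
    have "(\<Sum>b\<in>B. c b *\<^sub>R b) \<bullet> b' = c b'" if "b' \<in> B" for b'
    proof -
      have "(\<Sum>b\<in>B. c b *\<^sub>R b) \<bullet> b' = (\<Sum>b\<in>B. if b = b' then c b' else 0)"
        unfolding inner_sum_left
        by (rule sum.cong) (use orth norm that in \<open>auto simp: pairwise_def orthogonal_def norm_eq_1\<close>)
      then show ?thesis using fin that by simp
    qed
    then show ?thesis
      unfolding x by (simp add: inner_sum_right mult.commute)
  qed
  have "\<mu> *\<^sub>R x = (\<Sum>b\<in>B. (c b * \<mu>) *\<^sub>R b)"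
    by (simp add: x scaleR_right.sum mult.commute)
  then have "x \<bullet> (\<mu> *\<^sub>R x) = (\<Sum>b\<in>B. c b * (c b * \<mu>))"
    using inner by simp
  then have "\<mu> * (x \<bullet> x) = (\<Sum>b\<in>B. c b * (c b * \<mu>))"
    by simp
  moreover have "x \<bullet> (A *v x) = (\<Sum>b\<in>B. c b * (c b * ev b))"
    unfolding Ax by (rule inner)
  ultimately have gap: "\<mu> * (x \<bullet> x) - x \<bullet> (A *v x) = (\<Sum>b\<in>B. (c b)\<^sup>2 * (\<mu> - ev b))"
    by (simp add: sum_subtractf[symmetric] power2_eq_square algebra_simps)
  have nonneg: "0 \<le> (c b)\<^sup>2 * (\<mu> - ev b)" if "b \<in> B" for b
    using le[OF that] by simp
  have "x \<bullet> (A *v x) \<le> \<mu> * (x \<bullet> x)"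
    using gap sum_nonneg[of B "\<lambda>b. (c b)\<^sup>2 * (\<mu> - ev b)"] nonneg by simp
  moreover have "A *v x = \<mu> *\<^sub>R x" if "x \<bullet> (A *v x) = \<mu> * (x \<bullet> x)"
  proof -
    have "\<forall>b\<in>B. (c b)\<^sup>2 * (\<mu> - ev b) = 0"
      using gap that nonneg sum_nonneg_eq_0_iff[OF fin, of "\<lambda>b. (c b)\<^sup>2 * (\<mu> - ev b)"] by simp
    then have "A *v x = (\<Sum>b\<in>B. (c b * \<mu>) *\<^sub>R b)"
      unfolding Ax by (intro sum.cong) auto
    then show ?thesis
      by (simp add: x scaleR_right.sum mult.commute)
  qed
  ultimately show "x \<bullet> (A *v x) \<le> \<mu> * (x \<bullet> x) \<and>
      (x \<bullet> (A *v x) = \<mu> * (x \<bullet> x) \<longrightarrow> A *v x = \<mu> *\<^sub>R x)"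
    by blast
qed

section \<open>Eigenvalues as roots of the characteristic polynomial\<close>

lemma poly_charpoly: "poly (charpoly K) x = det (mat x - K)"
  by (simp add: charpoly_def det_def poly_sum poly_prod mat_def map_matrix_def of_int_poly if_distrib[of "\<lambda>p. poly p x"] cong: if_cong)

text \<open>
  Similarity is stated as \<open>Q K = L Q\<close> with \<open>Q\<close> nonsingular, which avoids matrix inverses. Comparing
  polynomials by their values on the reals reduces the claim to determinants of real matrices.
\<close>

lemma charpoly_similar:
  fixes K L :: "real^'n^'n"
  assumes "Q ** K = L ** Q" and "det Q \<noteq> 0"
  shows "charpoly K = charpoly L"
proof -
  have "det (mat x - K) = det (mat x - L)" for x
  proof -
    have "Q ** mat x = mat x ** Q"
      by (simp add: vec_eq_iff matrix_matrix_mult_def mat_def if_distrib if_distribR mult.commute cong: if_cong)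
    moreover have "Q ** (mat x - K) = Q ** mat x - Q ** K" "(mat x - L) ** Q = mat x ** Q - L ** Q"
      by (simp_all add: vec_eq_iff matrix_matrix_mult_def algebra_simps sum_subtractf)
    ultimately have "Q ** (mat x - K) = (mat x - L) ** Q"
      using assms(1) by simp
    then have "det Q * det (mat x - K) = det (mat x - L) * det Q"
      by (metis det_mul)
    then show ?thesis using assms(2) by simp
  qed
  then show ?thesis
    by (simp add: poly_eq_poly_eq_iff[symmetric] fun_eq_iff poly_charpoly)
qed

text \<open>
  The matrix \<open>Q\<close> with the basis vectors as columns conjugates \<open>A\<close> to the diagonal matrix of its
  eigenvalues, whose characteristic polynomial is a product of linear factors.
\<close>

lemma proots_charpoly_eigenbasis:
  fixes A :: "real^'n^'n"
  assumes "finite B" "pairwise orthogonal B" "\<And>b. b \<in> B \<Longrightarrow> norm b = 1" "card B = CARD('n)"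
    and eig: "\<And>b. b \<in> B \<Longrightarrow> A *v b = ev b *\<^sub>R b"
  shows "proots (charpoly A) = image_mset ev (mset_set B)"
proof -
  obtain h :: "'n \<Rightarrow> real^'n" where h: "bij_betw h UNIV B"
    using assms(1,4) by (metis finite_UNIV finite_same_card_bij finite_class.finite_UNIV)
  then have hB: "h i \<in> B" and inj: "h i = h j \<longleftrightarrow> i = j" for i j
    by (auto simp: bij_betw_def inj_eq)
  define Q :: "real^'n^'n" where "Q = (\<chi> i j. h j $ i)"
  define D :: "real^'n^'n" where "D = (\<chi> i j. if i = j then ev (h i) else 0)"
  have "transpose Q ** Q = mat 1"
  proof -
    have "(transpose Q ** Q) $ i $ j = h i \<bullet> h j" for i j
      by (simp add: Q_def transpose_def matrix_matrix_mult_def inner_vec_def)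
    moreover have "h i \<bullet> h j = (if i = j then 1 else 0)" for i j
      using assms(2,3) hB[of i] hB[of j] inj[of i j]
      by (auto simp: pairwise_def orthogonal_def norm_eq_1)
    ultimately show ?thesis by (simp add: vec_eq_iff mat_def)
  qed
  then have "det (transpose Q) * det Q = 1"
    by (metis det_I det_mul)
  then have "det Q \<noteq> 0" by auto
  moreover have "Q ** D = A ** Q"
  proof -
    have "(A ** Q) $ i $ j = (A *v h j) $ i" for i j
      by (simp add: Q_def matrix_matrix_mult_def matrix_vector_mult_def)
    then show ?thesis
      by (simp add: vec_eq_iff eig hB matrix_matrix_mult_def Q_def D_def if_distrib mult.commute cong: if_cong)
  qed
  ultimately have "charpoly D = charpoly A"
    by (rule charpoly_similar[rotated])
  moreover have "charpoly D = (\<Prod>i\<in>UNIV. [:- ev (h i), 1:])"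
    unfolding charpoly_def
    by (subst det_diagonal) (auto simp: D_def mat_def map_matrix_def)
  ultimately have "charpoly A = (\<Prod>b\<in>B. [:- ev b, 1:])"
    using prod.reindex_bij_betw[OF h, of "\<lambda>b. [:- ev b, 1:]"] by simp
  then have "proots (charpoly A) = (\<Sum>b\<in>B. {#ev b#})"
    by (simp add: proots_prod)
  also have "\<dots> = image_mset ev (mset_set B)"
    using assms(1) by (induction B rule: finite_induct) auto
  finally show ?thesis .
qed

text \<open>
  The bridge from \<^const>\<open>eigval\<close>, defined through roots of the characteristic polynomial, to
  eigenvectors: sorting an eigenbasis by decreasing eigenvalue reproduces the list of eigenvalues,
  multiplicities included.
\<close>

lemma symmetric_sorted_eigenbasis:
  fixes A :: "real^'n^'n"
  assumes sym: "transpose A = A"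
  obtains bs ev where "length bs = CARD('n)" "distinct bs" "pairwise orthogonal (set bs)"
    "\<And>b. b \<in> set bs \<Longrightarrow> norm b = 1" "\<And>b. b \<in> set bs \<Longrightarrow> A *v b = ev b *\<^sub>R b"
    "map ev bs = eigvals_desc A" "sorted_wrt (\<ge>) (map ev bs)"
proof -
  have "\<exists>B. B \<subseteq> (UNIV :: (real^'n) set) \<and> finite B \<and> pairwise orthogonal B \<and>
      card B = dim (UNIV :: (real^'n) set) \<and> (\<forall>b\<in>B. norm b = 1 \<and> (\<exists>\<mu>. A *v b = \<mu> *\<^sub>R b))"
    by (rule symmetric_orthonormal_eigenbasis[OF sym]) auto
  then obtain B where B: "finite B" "pairwise orthogonal B" "card B = CARD('n)"
      "\<And>b. b \<in> B \<Longrightarrow> norm b = 1" and "\<And>b. b \<in> B \<Longrightarrow> \<exists>\<mu>. A *v b = \<mu> *\<^sub>R b"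
    by auto
  then obtain ev where ev: "\<And>b. b \<in> B \<Longrightarrow> A *v b = ev b *\<^sub>R b"
    by metis
  obtain xs where xs: "set xs = B" "distinct xs"
    using finite_distinct_list[OF B(1)] by blast
  define bs where "bs = rev (sort_key ev xs)"
  have set: "set bs = B" and dist: "distinct bs"
    by (simp_all add: bs_def xs)
  have "proots (charpoly A) = mset (map ev xs)"
    using proots_charpoly_eigenbasis[OF B(1,2,4,3) ev] xs by (simp add: mset_set_set[symmetric])
  then have "eigvals_desc A = rev (sort (map ev xs))"
    by (simp add: eigvals_desc_def del: mset_map)
  also have "sort (map ev xs) = map ev (sort_key ev xs)"
    by (rule properties_for_sort) simp_all
  finally have "map ev bs = eigvals_desc A"
    by (simp add: bs_def rev_map)
  moreover have "sorted_wrt (\<ge>) (map ev bs)"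
    by (simp add: bs_def rev_map[symmetric] sorted_wrt_rev)
  moreover have "length bs = CARD('n)"
    using B(3) set dist distinct_card by fastforce
  ultimately show thesis
    using that[of bs ev] set dist B ev by simp
qed

lemma dim_span_orthonormal:
  assumes "pairwise orthogonal B" and "\<And>b. b \<in> B \<Longrightarrow> norm b = 1"
  shows "dim (span B) = card B"
proof -
  have "0 \<notin> B" using assms(2) by force
  then show ?thesis
    using assms(1) by (simp add: pairwise_orthogonal_independent dim_eq_card_independent)
qed

text \<open>
  The subspace is spanned by the eigenvectors numbered \<open>i, \<dots>, n\<close> of a sorted eigenbasis.
\<close>

lemma rayleigh_le_lower_eigenspaces:
  fixes A :: "real^'n^'n"
  assumes sym: "transpose A = A" and i: "i \<in> {1..CARD('n)}"
  obtains U where "subspace U" "dim U + i = CARD('n) + 1" "rayleigh_le A (eigval A i) U"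
proof -
  obtain bs ev where bs: "length bs = CARD('n)" "distinct bs" "pairwise orthogonal (set bs)"
    "\<And>b. b \<in> set bs \<Longrightarrow> norm b = 1" "\<And>b. b \<in> set bs \<Longrightarrow> A *v b = ev b *\<^sub>R b"
    "map ev bs = eigvals_desc A" "sorted_wrt (\<ge>) (map ev bs)"
    by (rule symmetric_sorted_eigenbasis[OF sym]) blast
  let ?B = "set (drop (i - 1) bs)"
  have sub: "?B \<subseteq> set bs" by (rule set_drop_subset)
  have orth: "pairwise orthogonal ?B"
    using bs(3) sub by (rule pairwise_subset)
  have "i - 1 < length bs"
    using i bs(1) by auto
  then have eigval: "eigval A i = ev (bs ! (i - 1))"
    by (simp add: eigval_def bs(6)[symmetric])
  have "ev b \<le> eigval A i" if "b \<in> ?B" for b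
  proof -
    obtain m where "m < length (drop (i - 1) bs)" "drop (i - 1) bs ! m = b"
      using \<open>b \<in> ?B\<close> unfolding in_set_conv_nth by blast
    then have m: "i - 1 + m < length bs" "b = bs ! (i - 1 + m)"
      by auto
    show ?thesis
      using sorted_wrt_nth_less[OF bs(7), of "i - 1" "i - 1 + m"] m
      by (cases m) (auto simp: eigval)
  qed
  then have "rayleigh_le A (eigval A i) (span ?B)"
    using orth sub bs(4,5) by (intro rayleigh_le_span_eigenvectors[of _ A ev]) auto
  moreover have "dim (span ?B) = CARD('n) - (i - 1)"
    using dim_span_orthonormal[OF orth] sub bs(1,2,4) by (simp add: distinct_card subset_iff)
  ultimately show thesis
    using i by (intro that[of "span ?B"]) auto
qed

lemma uminus_matrix_vector_mult: "(- A) *v x = - (A *v x)" for A :: "real^'n^'n"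
  by (simp add: vec_eq_iff matrix_vector_mult_def sum_negf)

text \<open>
  The mirror image, with the eigenvectors numbered \<open>1, \<dots>, i\<close>: there the Rayleigh quotient is at
  least the \<open>i\<close>-th eigenvalue, which is an upper bound for \<open>- A\<close>.
\<close>

lemma rayleigh_le_upper_eigenspaces:
  fixes A :: "real^'n^'n"
  assumes sym: "transpose A = A" and i: "i \<in> {1..CARD('n)}"
  obtains U where "subspace U" "dim U = i" "rayleigh_le (- A) (- eigval A i) U"
proof -
  obtain bs ev where bs: "length bs = CARD('n)" "distinct bs" "pairwise orthogonal (set bs)"
    "\<And>b. b \<in> set bs \<Longrightarrow> norm b = 1" "\<And>b. b \<in> set bs \<Longrightarrow> A *v b = ev b *\<^sub>R b"
    "map ev bs = eigvals_desc A" "sorted_wrt (\<ge>) (map ev bs)"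
    by (rule symmetric_sorted_eigenbasis[OF sym]) blast
  let ?B = "set (take i bs)"
  have sub: "?B \<subseteq> set bs" by (rule set_take_subset)
  have orth: "pairwise orthogonal ?B"
    using bs(3) sub by (rule pairwise_subset)
  have "i - 1 < length bs"
    using i bs(1) by auto
  then have eigval: "eigval A i = ev (bs ! (i - 1))"
    by (simp add: eigval_def bs(6)[symmetric])
  have "- ev b \<le> - eigval A i" if "b \<in> ?B" for b
  proof -
    obtain m where "m < length (take i bs)" "take i bs ! m = b"
      using \<open>b \<in> ?B\<close> unfolding in_set_conv_nth by blast
    then have m: "m < i" "m < length bs" "b = bs ! m"
      by auto
    show ?thesis
      using sorted_wrt_nth_less[OF bs(7), of m "i - 1"] m i bs(1)
      by (cases "m = i - 1") (auto simp: eigval)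
  qed
  then have "rayleigh_le (- A) (- eigval A i) (span ?B)"
    using orth sub bs(4,5)
    by (intro rayleigh_le_span_eigenvectors[of _ "- A" "\<lambda>b. - ev b"]) (auto simp: uminus_matrix_vector_mult)
  moreover have "dim (span ?B) = i"
    using dim_span_orthonormal[OF orth] sub bs(1,2,4) i by (simp add: distinct_card subset_iff)
  ultimately show thesis
    by (intro that[of "span ?B"]) auto
qed

section \<open>Symmetrizing self-adjoint kernels\<close>

text \<open>
  The conjugate of \<open>K\<close> by the diagonal matrix \<open>D\<close> with entries \<open>sqrt (\<pi> x)\<close>. The map \<open>f \<mapsto> D f\<close> is an
  isometry from \<open>l\<^sup>2(\<pi>)\<close> onto the standard inner product space, so self-adjoint kernels on \<open>l\<^sup>2(\<pi>)\<close>
  become symmetric matrices with the same eigenvalues.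
\<close>

definition symmetrization :: "real^'n \<Rightarrow> real^'n^'n \<Rightarrow> real^'n^'n" where
  "symmetrization \<pi> K = (\<chi> x y. sqrt (\<pi> $ x) * K $ x $ y / sqrt (\<pi> $ y))"

lemma symmetrization_add:
  "symmetrization \<pi> (K + L) = symmetrization \<pi> K + symmetrization \<pi> L"
  by (simp add: symmetrization_def vec_eq_iff distrib_left add_divide_distrib)

text \<open>
  Testing self-adjointness on the indicator functions of two states gives the entrywise form.
\<close>

lemma self_adjoint_l2_detailed_balance:
  fixes K :: "real^'n^'n"
  assumes "self_adjoint_l2 \<pi> K"
  shows "\<pi> $ x * K $ x $ y = \<pi> $ y * K $ y $ x"
proof -
  have ap: "kernel_apply K (axis b 1) $ a = complex_of_real (K $ a $ b)" for a b
    by (simp add: kernel_apply_def matrix_vector_mult_def map_matrix_def axis_def if_distrib cong: if_cong)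
  have "l2_inner \<pi> (kernel_apply K (axis y 1)) (axis x 1) = complex_of_real (K $ x $ y * \<pi> $ x)"
    unfolding l2_inner_def ap by (simp add: axis_def if_distrib if_distribR cong: if_cong)
  moreover have "l2_inner \<pi> (axis y 1) (kernel_apply K (axis x 1)) = complex_of_real (K $ y $ x * \<pi> $ y)"
    unfolding l2_inner_def ap by (simp add: axis_def if_distrib if_distribR cong: if_cong)
  ultimately have "complex_of_real (K $ x $ y * \<pi> $ x) = complex_of_real (K $ y $ x * \<pi> $ y)"
    using assms by (metis self_adjoint_l2_def)
  then show ?thesis
    unfolding of_real_eq_iff by (simp add: mult.commute)
qed

lemma transpose_symmetrization:
  fixes K :: "real^'n^'n"
  assumes pos: "\<And>x. \<pi> $ x > 0" and K: "self_adjoint_l2 \<pi> K"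
  shows "transpose (symmetrization \<pi> K) = symmetrization \<pi> K"
proof -
  have "sqrt (\<pi> $ y) * K $ y $ x / sqrt (\<pi> $ x) = sqrt (\<pi> $ x) * K $ x $ y / sqrt (\<pi> $ y)" for x y
    using self_adjoint_l2_detailed_balance[OF K, of x y] pos[of x] pos[of y]
    by (simp add: frac_eq_eq mult_ac) (simp add: mult.assoc[symmetric])
  then show ?thesis
    by (simp add: symmetrization_def transpose_def vec_eq_iff)
qed

lemma eigval_symmetrization:
  fixes K :: "real^'n^'n"
  assumes pos: "\<And>x. \<pi> $ x > 0"
  shows "eigval (symmetrization \<pi> K) = eigval K"
proof -
  define Q :: "real^'n^'n" where "Q = (\<chi> x y. if x = y then sqrt (\<pi> $ x) else 0)"
  have nz: "\<pi> $ x \<noteq> 0" for x using pos[of x] by simp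
  have "det Q = (\<Prod>x\<in>UNIV. sqrt (\<pi> $ x))"
    by (subst det_diagonal) (auto simp: Q_def)
  then have "det Q \<noteq> 0"
    by (simp add: nz)
  moreover have "Q ** K = symmetrization \<pi> K ** Q"
    by (simp add: Q_def symmetrization_def vec_eq_iff matrix_matrix_mult_def nz if_distrib if_distribR cong: if_cong)
  ultimately have "charpoly K = charpoly (symmetrization \<pi> K)"
    by (rule charpoly_similar[rotated])
  then show ?thesis
    by (simp add: eigval_def eigvals_desc_def fun_eq_iff)
qed

text \<open>
  The inverse of the isometry \<open>D\<close>, taking real vectors to elements of \<open>l\<^sup>2(\<pi>)\<close>; real eigenvectors
  suffice as witnesses for the equality cases.
\<close>

definition unsymmetrize :: "real^'n \<Rightarrow> real^'n \<Rightarrow> complex^'n" where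
  "unsymmetrize \<pi> g = (\<chi> x. complex_of_real (g $ x / sqrt (\<pi> $ x)))"

lemma l2_norm_unsymmetrize:
  assumes pos: "\<And>x. \<pi> $ x > 0"
  shows "l2_norm \<pi> (unsymmetrize \<pi> g) = norm g"
proof -
  have "g $ x / sqrt (\<pi> $ x) * (g $ x / sqrt (\<pi> $ x)) * \<pi> $ x = g $ x * g $ x" for x
    using pos[of x] by (simp add: field_simps)
  then have "l2_inner \<pi> (unsymmetrize \<pi> g) (unsymmetrize \<pi> g) = complex_of_real (g \<bullet> g)"
    unfolding l2_inner_def unsymmetrize_def inner_vec_def of_real_sum
    by (intro sum.cong) (simp_all only: vec_lambda_beta complex_cnj_complex_of_real of_real_mult[symmetric] inner_real_def)
  then show ?thesis
    by (simp add: l2_norm_def norm_eq_sqrt_inner)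
qed

lemma kernel_apply_unsymmetrize:
  assumes pos: "\<And>x. \<pi> $ x > 0" and eig: "symmetrization \<pi> K *v g = \<mu> *\<^sub>R g"
  shows "kernel_apply K (unsymmetrize \<pi> g) = \<mu> *\<^sub>R unsymmetrize \<pi> g"
proof -
  have "(\<Sum>y\<in>UNIV. K $ x $ y * (g $ y / sqrt (\<pi> $ y))) = \<mu> * (g $ x / sqrt (\<pi> $ x))" for x
  proof -
    have "sqrt (\<pi> $ x) * (\<Sum>y\<in>UNIV. K $ x $ y * (g $ y / sqrt (\<pi> $ y))) = (symmetrization \<pi> K *v g) $ x"
      by (simp add: symmetrization_def matrix_vector_mult_def sum_distrib_left mult_ac)
    also have "\<dots> = \<mu> * g $ x" by (simp add: eig)
    finally show ?thesis
      using pos[of x] by (simp add: field_simps)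
  qed
  note eq = this
  have "kernel_apply K (unsymmetrize \<pi> g) $ x = (\<mu> *\<^sub>R unsymmetrize \<pi> g) $ x" for x
    using arg_cong[OF eq[of x], of complex_of_real]
    unfolding vector_scaleR_component unfolding scaleR_conv_of_real
    by (simp add: kernel_apply_def unsymmetrize_def matrix_vector_mult_def map_matrix_def)
  then show ?thesis by (simp add: vec_eq_iff)
qed

lemma kernel_apply_add: "kernel_apply (K + L) f = kernel_apply K f + kernel_apply L f"
  by (simp add: kernel_apply_def vec_eq_iff matrix_vector_mult_def map_matrix_def distrib_right sum.distrib)

section \<open>Weyl inequalities on \<open>l\<^sup>2(\<pi>)\<close>\<close>

text \<open>
  The equality case in the form shared by both inequalities. Rayleigh bounds provide a real common
  eigenvector \<open>g\<close> of the symmetrized kernels, which is transported back to \<open>l\<^sup>2(\<pi>)\<close> and normalized.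
  Conversely, applying \<open>K + L\<close> to a common eigenvector shows that the eigenvalues add.
\<close>

lemma eigenvalue_sum_iff_common_eigenvector:
  fixes K L :: "real^'n^'n"
  assumes pos: "\<And>x. \<pi> $ x > 0"
    and eq: "\<sigma> = \<alpha> + \<beta> \<Longrightarrow> \<exists>g. g \<noteq> 0 \<and> symmetrization \<pi> K *v g = \<alpha> *\<^sub>R g \<and> symmetrization \<pi> L *v g = \<beta> *\<^sub>R g"
  shows "\<sigma> = \<alpha> + \<beta> \<longleftrightarrow>
    (\<exists>f. l2_norm \<pi> f = 1 \<and> kernel_apply K f = \<alpha> *\<^sub>R f \<and> kernel_apply L f = \<beta> *\<^sub>R f \<and>
         kernel_apply (K + L) f = \<sigma> *\<^sub>R f)" (is "?eq \<longleftrightarrow> ?ex")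
proof
  assume ?eq
  with eq obtain g where g: "g \<noteq> 0" "symmetrization \<pi> K *v g = \<alpha> *\<^sub>R g" "symmetrization \<pi> L *v g = \<beta> *\<^sub>R g"
    by blast
  define h where "h = g /\<^sub>R norm g"
  have h: "symmetrization \<pi> K *v h = \<alpha> *\<^sub>R h" "symmetrization \<pi> L *v h = \<beta> *\<^sub>R h"
    unfolding h_def matrix_vector_mult_scaleR g(2,3) by (simp_all only: scaleR_left_commute)
  have "kernel_apply K (unsymmetrize \<pi> h) = \<alpha> *\<^sub>R unsymmetrize \<pi> h"
       "kernel_apply L (unsymmetrize \<pi> h) = \<beta> *\<^sub>R unsymmetrize \<pi> h"
    using kernel_apply_unsymmetrize[OF pos h(1)] kernel_apply_unsymmetrize[OF pos h(2)] .
  moreover have "l2_norm \<pi> (unsymmetrize \<pi> h) = 1"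
    using g(1) by (simp add: l2_norm_unsymmetrize[OF pos] h_def)
  ultimately show ?ex
    unfolding \<open>?eq\<close> by (intro exI[of _ "unsymmetrize \<pi> h"]) (simp add: kernel_apply_add scaleR_left_distrib)
next
  assume ?ex
  then obtain f where f: "l2_norm \<pi> f = 1" "kernel_apply K f = \<alpha> *\<^sub>R f"
      "kernel_apply L f = \<beta> *\<^sub>R f" "kernel_apply (K + L) f = \<sigma> *\<^sub>R f"
    by blast
  have "f \<noteq> 0"
    using f(1) by (auto simp: l2_norm_def l2_inner_def)
  moreover have "\<sigma> *\<^sub>R f = (\<alpha> + \<beta>) *\<^sub>R f"
    using f kernel_apply_add[of K L f] by (simp add: scaleR_left_distrib)
  ultimately show ?eq by simp
qed

text \<open>
  Weyl's upper inequality: the subspaces of dimensions \<open>n + 1 - j\<close>, \<open>n + 1 - k\<close> and \<open>i = j + k - 1\<close>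
  have total dimension \<open>2n + 1\<close>, just enough to meet.
\<close>

lemma weyl_upper:
  fixes K L :: "real^'n^'n"
  assumes pos: "\<And>x. \<pi> $ x > 0" and sa: "self_adjoint_l2 \<pi> K" "self_adjoint_l2 \<pi> L" "self_adjoint_l2 \<pi> (K + L)"
    and ijk: "i \<in> {1..CARD('n)}" "j \<in> {1..CARD('n)}" "k \<in> {1..CARD('n)}" "i + 1 = j + k"
  shows "eigval (K + L) i \<le> eigval K j + eigval L k"
    and "eigval (K + L) i = eigval K j + eigval L k \<longleftrightarrow>
      (\<exists>f. l2_norm \<pi> f = 1 \<and> kernel_apply K f = eigval K j *\<^sub>R f \<and>
           kernel_apply L f = eigval L k *\<^sub>R f \<and> kernel_apply (K + L) f = eigval (K + L) i *\<^sub>R f)"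
proof -
  let ?A = "symmetrization \<pi> K" and ?B = "symmetrization \<pi> L" and ?C = "symmetrization \<pi> (K + L)"
  note [simp] = eigval_symmetrization[OF pos]
  obtain U where U: "subspace U" "dim U + j = CARD('n) + 1" "rayleigh_le ?A (eigval K j) U"
    using rayleigh_le_lower_eigenspaces[OF transpose_symmetrization[OF pos sa(1)] ijk(2)] by auto
  obtain V where V: "subspace V" "dim V + k = CARD('n) + 1" "rayleigh_le ?B (eigval L k) V"
    using rayleigh_le_lower_eigenspaces[OF transpose_symmetrization[OF pos sa(2)] ijk(3)] by auto
  obtain W where W: "subspace W" "dim W = i" "rayleigh_le (- ?C) (- eigval (K + L) i) W"
    using rayleigh_le_upper_eigenspaces[OF transpose_symmetrization[OF pos sa(3)] ijk(1)] by auto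
  have zero: "?A + ?B + - ?C = 0"
    by (simp add: symmetrization_add)
  have dims: "2 * CARD('n) < dim U + dim V + dim W"
    using U(2) V(2) W(2) ijk(4) by linarith
  note Z = rayleigh_le_zero_sum[OF zero U(1) V(1) W(1) dims U(3) V(3) W(3)]
  show "eigval (K + L) i \<le> eigval K j + eigval L k"
    using Z(1) by simp
  show "eigval (K + L) i = eigval K j + eigval L k \<longleftrightarrow>
      (\<exists>f. l2_norm \<pi> f = 1 \<and> kernel_apply K f = eigval K j *\<^sub>R f \<and>
           kernel_apply L f = eigval L k *\<^sub>R f \<and> kernel_apply (K + L) f = eigval (K + L) i *\<^sub>R f)"
    by (rule eigenvalue_sum_iff_common_eigenvector[OF pos]) (use Z(2) in simp)
qed

text \<open>
  The lower inequality exchanges the two kinds of eigenspaces; the dimensions \<open>l\<close>, \<open>m\<close> and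
  \<open>n + 1 - i\<close> again add up to \<open>2n + 1\<close>.
\<close>

lemma weyl_lower:
  fixes K L :: "real^'n^'n"
  assumes pos: "\<And>x. \<pi> $ x > 0" and sa: "self_adjoint_l2 \<pi> K" "self_adjoint_l2 \<pi> L" "self_adjoint_l2 \<pi> (K + L)"
    and ilm: "i \<in> {1..CARD('n)}" "l \<in> {1..CARD('n)}" "m \<in> {1..CARD('n)}" "i + CARD('n) = l + m"
  shows "eigval K l + eigval L m \<le> eigval (K + L) i"
    and "eigval (K + L) i = eigval K l + eigval L m \<longleftrightarrow>
      (\<exists>f. l2_norm \<pi> f = 1 \<and> kernel_apply K f = eigval K l *\<^sub>R f \<and>
           kernel_apply L f = eigval L m *\<^sub>R f \<and> kernel_apply (K + L) f = eigval (K + L) i *\<^sub>R f)"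
proof -
  let ?A = "symmetrization \<pi> K" and ?B = "symmetrization \<pi> L" and ?C = "symmetrization \<pi> (K + L)"
  note [simp] = eigval_symmetrization[OF pos]
  obtain U where U: "subspace U" "dim U = l" "rayleigh_le (- ?A) (- eigval K l) U"
    using rayleigh_le_upper_eigenspaces[OF transpose_symmetrization[OF pos sa(1)] ilm(2)] by auto
  obtain V where V: "subspace V" "dim V = m" "rayleigh_le (- ?B) (- eigval L m) V"
    using rayleigh_le_upper_eigenspaces[OF transpose_symmetrization[OF pos sa(2)] ilm(3)] by auto
  obtain W where W: "subspace W" "dim W + i = CARD('n) + 1" "rayleigh_le ?C (eigval (K + L) i) W"
    using rayleigh_le_lower_eigenspaces[OF transpose_symmetrization[OF pos sa(3)] ilm(1)] by auto
  have zero: "- ?A + - ?B + ?C = 0"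
    by (simp add: symmetrization_add)
  have dims: "2 * CARD('n) < dim U + dim V + dim W"
    using U(2) V(2) W(2) ilm(4) by linarith
  note Z = rayleigh_le_zero_sum[OF zero U(1) V(1) W(1) dims U(3) V(3) W(3)]
  show "eigval K l + eigval L m \<le> eigval (K + L) i"
    using Z(1) by simp
  show "eigval (K + L) i = eigval K l + eigval L m \<longleftrightarrow>
      (\<exists>f. l2_norm \<pi> f = 1 \<and> kernel_apply K f = eigval K l *\<^sub>R f \<and>
           kernel_apply L f = eigval L m *\<^sub>R f \<and> kernel_apply (K + L) f = eigval (K + L) i *\<^sub>R f)"
    by (rule eigenvalue_sum_iff_common_eigenvector[OF pos]) (use Z(2) in \<open>simp add: uminus_matrix_vector_mult\<close>)
qed

section \<open>The Metropolis-Hastings kernels\<close>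

text \<open>
  Off the diagonal, minimum and maximum of two numbers add up to their sum; on the diagonal the
  rejection terms cancel and \<open>P\<^sup>*\<close> agrees with \<open>P\<close>.
\<close>

lemma MH1_plus_MH2:
  assumes pos: "\<And>x. \<pi> $ x > 0"
  shows "MH1 \<pi> P + MH2 \<pi> P = P + l2_adjoint \<pi> P"
proof -
  have "\<pi> $ x \<noteq> 0" for x using pos[of x] by simp
  then show ?thesis
    by (auto simp: vec_eq_iff MH1_def MH2_def l2_adjoint_def min_def max_def)
qed

theorem theorem3p1:
  fixes P :: "real^'s^'s" and \<pi> :: "real^'s"
  assumes "stochastic P"
    and "irreducible_matrix P"
    and "stationary_distribution \<pi> P"
    and "\<And>x. \<pi> $ x > 0"
  defines "S \<equiv> P + l2_adjoint \<pi> P"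
    and "M1 \<equiv> MH1 \<pi> P"
    and "M2 \<equiv> MH2 \<pi> P"
  shows
    "(\<forall>i j k :: nat. i \<in> {1..CARD('s)} \<and> j \<in> {1..CARD('s)} \<and> k \<in> {1..CARD('s)} \<and> i + 1 = j + k \<longrightarrow>
        eigval S i \<le> eigval M1 j + eigval M2 k \<and>
        (eigval S i = eigval M1 j + eigval M2 k \<longleftrightarrow>
          (\<exists>f :: complex^'s. l2_norm \<pi> f = 1 \<and>
             kernel_apply M1 f = eigval M1 j *\<^sub>R f \<and>
             kernel_apply M2 f = eigval M2 k *\<^sub>R f \<and>
             kernel_apply S f = eigval S i *\<^sub>R f))) \<and>
     (\<forall>i l m :: nat. i \<in> {1..CARD('s)} \<and> l \<in> {1..CARD('s)} \<and> m \<in> {1..CARD('s)} \<and> i + CARD('s) = l + m \<longrightarrow>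
        eigval M1 l + eigval M2 m \<le> eigval S i \<and>
        (eigval S i = eigval M1 l + eigval M2 m \<longleftrightarrow>
          (\<exists>f :: complex^'s. l2_norm \<pi> f = 1 \<and>
             kernel_apply M1 f = eigval M1 l *\<^sub>R f \<and>
             kernel_apply M2 f = eigval M2 m *\<^sub>R f \<and>
             kernel_apply S f = eigval S i *\<^sub>R f)))"
proof -
  have sum: "M1 + M2 = S"
    unfolding S_def M1_def M2_def by (rule MH1_plus_MH2[OF assms(4)])
  have sa: "self_adjoint_l2 \<pi> M1" "self_adjoint_l2 \<pi> M2" "self_adjoint_l2 \<pi> (M1 + M2)"
    unfolding sum unfolding S_def M1_def M2_def
    by (rule self_adjoint_MH1[OF assms(4)] self_adjoint_MH2[OF assms(4)]
        self_adjoint_additive_reversibilization[OF assms(4)])+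
  show ?thesis
    by (intro conjI allI impI; elim conjE)
       (rule weyl_upper[OF assms(4) sa, unfolded sum] weyl_lower[OF assms(4) sa, unfolded sum];
        assumption)+
qed

end
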